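(* Let $F$ be an endofunctor on a category $\mathbb{B}$, $(F,m)$ a non-unital monad and $(F,\delta)$ a non-counital comonad such that $(F,m,\delta)$ satisfies the Frobenius property. Let $\varepsilon:F\to I_{\mathbb{B}}$ be such that $(F,\delta,\varepsilon)$ is a weak comonad, put $\gamma:=\varepsilon F\cdot\delta:F\to F$, and assume $m=\gamma\cdot m$. Then: (1) For any $\gamma$-compatible $F$-comodule $(B,\omega)$ there is a unique $\gamma$-compatible $F$-comodule morphism $\varrho:F(B)\to B$ making $(B,\varrho,\omega)$ a Frobenius bimodule, namely $$\varrho:\ F(B)\xrightarrow{F(\omega)}FF(B)\xrightarrow{m_B}F(B)\xrightarrow{\varepsilon_B}B.$$ (2) Any $F$-comodule morphism between $\gamma$-compatible comodules $(B,\omega)$ and $(B',\omega')$ becomes a morphism between the Frobenius bimodules $(B,\varrho,\omega)$ and $(B',\varrho',\omega')$, where $\varrho,\varrho'$ are obtained as in (1). (3) Let $\overline{\mathbb{B}}^F$ be the category of $\gamma$-compatible $F$-comodules, and let $\overline{\mathbb{B}}^F_F$ be the category of Frobenius bimodules which are $\gamma$-compatible as $F$-comodules. There is an isomorphism of categories $$\Psi:\overline{\mathbb{B}}^F\to\overline{\mathbb{B}}^F_F,\quad (B,\omega)\mapsto(B,\varrho,\omega)$$ (with $\varrho$ as in (1)), with the forgetful functor $U_F:\overline{\mathbb{B}}^F_F\to\overline{\mathbb{B}}^F$, $(B,\varrho,\omega)\mapsto(B,\omega)$, as inverse.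
   Context: A non-unital monad $(F,m)$ has an associative natural transformation $m:FF\to F$; its (non-unital) modules are pairs $(B,\varrho)$ with $\varrho:F(B)\to B$ and $\varrho\cdot F(\varrho)=\varrho\cdot m_B$. A non-counital comonad $(F,\delta)$ has a coassociative natural transformation $\delta:F\to FF$; its (non-counital) comodules are pairs $(B,\omega)$ with $\omega:B\to F(B)$ and $F(\omega)\cdot\omega=\delta_B\cdot\omega$. Each $F(B)$ is regarded as a comodule via $\delta_B$. Morphisms of (co)modules are morphisms in $\mathbb{B}$ commuting with the structure maps. $(F,\delta,\varepsilon)$ is a weak comonad if $\varepsilon=\varepsilon\cdot F\varepsilon\cdot\delta$, $\delta=F\varepsilon F\cdot F\delta\cdot\delta$ and $F\varepsilon\cdot\delta=\varepsilon F\cdot\delta$. A comodule $(B,\omega)$ is ($\gamma$-)compatible if $\gamma_B\cdot\omega=\omega$. A comodule morphism $h:(B,\omega)\to(B',\omega')$ is $\gamma$-compatible if $h\cdot\varepsilon_B\cdot\omega=h$ (equivalently $\varepsilon_{B'}\cdot\omega'\cdot h=h$); for $h$ with domain $(F(B),\delta_B)$ this means $h\cdot\gamma_B=h$. $(F,m,\delta)$ satisfies the Frobenius property if $Fm\cdot\delta F=\delta\cdot m=mF\cdot F\delta$. A Frobenius bimodule is a triple $(B,\varrho,\omega)$ with $(B,\varrho)$ a non-unital module, $(B,\omega)$ a non-counital comodule and $F(\varrho)\cdot\delta_B=\omega\cdot\varrho=m_B\cdot F(\omega)$. It is $\gamma$-compatible as an $F$-comodule if $(B,\omega)$ is a $\gamma$-compatible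 comodule. Morphisms of Frobenius bimodules are morphisms in $\mathbb{B}$ which are both module and comodule morphisms.
   Formalization: In (3) the isomorphism is onto the full subcategory of Frobenius bimodules, γ-compatible as comodules, whose action ϱ is also a γ-compatible morphism; without this (3) fails (F = Id, m = δ = ε = 0, ω = 0, ϱ ≠ 0 with ϱϱ = 0). On the full category only functoriality of Ψ and U_F is stated. *)

theory Defs
  imports Main
begin

section \<open>Categories, functors, natural transformations\<close>

text \<open>Hom sets are disjoint: every arrow carries its domain and codomain. The components of
  natural transformations, and the values of functors, are only relevant on the object and arrow
  sets.\<close>

record ('o, 'm) cat =
  Obj :: "'o set"
  Arr :: "'m set"
  Dom :: "'m \<Rightarrow> 'o"
  Cod :: "'m \<Rightarrow> 'o"
  Id :: "'o \<Rightarrow> 'm"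
  Comp :: "'m \<Rightarrow> 'm \<Rightarrow> 'm" (infixr "\<cdot>\<index>" 70)

definition hom :: "('o, 'm) cat \<Rightarrow> 'o \<Rightarrow> 'o \<Rightarrow> 'm set" where
  "hom C X Y = {f \<in> Arr C. Dom C f = X \<and> Cod C f = Y}"

locale category =
  fixes C :: "('o, 'm) cat" (structure)
  assumes Dom_Obj: "f \<in> Arr C \<Longrightarrow> Dom C f \<in> Obj C"
    and Cod_Obj: "f \<in> Arr C \<Longrightarrow> Cod C f \<in> Obj C"
    and Id_hom: "X \<in> Obj C \<Longrightarrow> Id C X \<in> hom C X X"
    and Comp_hom: "\<lbrakk>f \<in> hom C X Y; g \<in> hom C Y Z\<rbrakk> \<Longrightarrow> g \<cdot> f \<in> hom C X Z"
    and Id_left: "f \<in> hom C X Y \<Longrightarrow> Id C Y \<cdot> f = f"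
    and Id_right: "f \<in> hom C X Y \<Longrightarrow> f \<cdot> Id C X = f"
    and Comp_assoc: "\<lbrakk>f \<in> hom C W X; g \<in> hom C X Y; h \<in> hom C Y Z\<rbrakk>
      \<Longrightarrow> (h \<cdot> g) \<cdot> f = h \<cdot> (g \<cdot> f)"

record ('o, 'm, 'p, 'n) func =
  fobj :: "'o \<Rightarrow> 'p"
  farr :: "'m \<Rightarrow> 'n"

locale is_functor = source: category C + target: category D
  for C :: "('o, 'm) cat" and D :: "('p, 'n) cat" and F :: "('o, 'm, 'p, 'n) func" +
  assumes fobj_Obj: "X \<in> Obj C \<Longrightarrow> fobj F X \<in> Obj D"
    and farr_hom: "f \<in> hom C X Y \<Longrightarrow> farr F f \<in> hom D (fobj F X) (fobj F Y)"
    and farr_Id: "X \<in> Obj C \<Longrightarrow> farr F (Id C X) = Id D (fobj F X)"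
    and farr_Comp: "\<lbrakk>f \<in> hom C X Y; g \<in> hom C Y Z\<rbrakk>
      \<Longrightarrow> farr F (g \<cdot>\<^bsub>C\<^esub> f) = farr F g \<cdot>\<^bsub>D\<^esub> farr F f"

definition id_func :: "('o, 'm, 'o, 'm) func" where
  "id_func = \<lparr>fobj = (\<lambda>X. X), farr = (\<lambda>f. f)\<rparr>"

definition comp_func ::
    "('p, 'n, 'q, 'k) func \<Rightarrow> ('o, 'm, 'p, 'n) func \<Rightarrow> ('o, 'm, 'q, 'k) func" where
  "comp_func G F = \<lparr>fobj = (\<lambda>X. fobj G (fobj F X)), farr = (\<lambda>f. farr G (farr F f))\<rparr>"

definition func_agree ::
    "('o, 'm) cat \<Rightarrow> ('o, 'm, 'p, 'n) func \<Rightarrow> ('o, 'm, 'p, 'n) func \<Rightarrow> bool" where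
  "func_agree C F G \<longleftrightarrow>
     (\<forall>X\<in>Obj C. fobj F X = fobj G X) \<and> (\<forall>f\<in>Arr C. farr F f = farr G f)"

definition iso_with_inverse ::
    "('o, 'm) cat \<Rightarrow> ('p, 'n) cat \<Rightarrow> ('o, 'm, 'p, 'n) func \<Rightarrow> ('p, 'n, 'o, 'm) func \<Rightarrow> bool" where
  "iso_with_inverse C D F G \<longleftrightarrow>
     is_functor C D F \<and> is_functor D C G \<and>
     func_agree C (comp_func G F) id_func \<and> func_agree D (comp_func F G) id_func"

definition nat_trans ::
    "('o, 'm) cat \<Rightarrow> ('p, 'n) cat \<Rightarrow> ('o, 'm, 'p, 'n) func \<Rightarrow> ('o, 'm, 'p, 'n) func
      \<Rightarrow> ('o \<Rightarrow> 'n) \<Rightarrow> bool" where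
  "nat_trans C D F G \<tau> \<longleftrightarrow>
     is_functor C D F \<and> is_functor C D G \<and>
     (\<forall>X\<in>Obj C. \<tau> X \<in> hom D (fobj F X) (fobj G X)) \<and>
     (\<forall>f\<in>Arr C. farr G f \<cdot>\<^bsub>D\<^esub> \<tau> (Dom C f) = \<tau> (Cod C f) \<cdot>\<^bsub>D\<^esub> farr F f)"

definition full_subcat :: "('o, 'm) cat \<Rightarrow> ('o \<Rightarrow> bool) \<Rightarrow> ('o, 'm) cat" where
  "full_subcat C P =
     C\<lparr>Obj := {X \<in> Obj C. P X}, Arr := {f \<in> Arr C. P (Dom C f) \<and> P (Cod C f)}\<rparr>"


section \<open>Non-unital monads, non-counital comonads, weak comonads\<close>

definition nonunital_monad ::
    "('o, 'm) cat \<Rightarrow> ('o, 'm, 'o, 'm) func \<Rightarrow> ('o \<Rightarrow> 'm) \<Rightarrow> bool" where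
  "nonunital_monad B F m \<longleftrightarrow>
     nat_trans B B (comp_func F F) F m \<and>
     (\<forall>X\<in>Obj B. m X \<cdot>\<^bsub>B\<^esub> farr F (m X) = m X \<cdot>\<^bsub>B\<^esub> m (fobj F X))"

definition noncounital_comonad ::
    "('o, 'm) cat \<Rightarrow> ('o, 'm, 'o, 'm) func \<Rightarrow> ('o \<Rightarrow> 'm) \<Rightarrow> bool" where
  "noncounital_comonad B F \<delta> \<longleftrightarrow>
     nat_trans B B F (comp_func F F) \<delta> \<and>
     (\<forall>X\<in>Obj B. farr F (\<delta> X) \<cdot>\<^bsub>B\<^esub> \<delta> X = \<delta> (fobj F X) \<cdot>\<^bsub>B\<^esub> \<delta> X)"

definition weak_comonad ::
    "('o, 'm) cat \<Rightarrow> ('o, 'm, 'o, 'm) func \<Rightarrow> ('o \<Rightarrow> 'm) \<Rightarrow> ('o \<Rightarrow> 'm) \<Rightarrow> bool" where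
  "weak_comonad B F \<delta> \<epsilon> \<longleftrightarrow>
     noncounital_comonad B F \<delta> \<and> nat_trans B B F id_func \<epsilon> \<and>
     (\<forall>X\<in>Obj B.
        \<epsilon> X = \<epsilon> X \<cdot>\<^bsub>B\<^esub> farr F (\<epsilon> X) \<cdot>\<^bsub>B\<^esub> \<delta> X \<and>
        \<delta> X = farr F (\<epsilon> (fobj F X)) \<cdot>\<^bsub>B\<^esub> farr F (\<delta> X) \<cdot>\<^bsub>B\<^esub> \<delta> X \<and>
        farr F (\<epsilon> X) \<cdot>\<^bsub>B\<^esub> \<delta> X = \<epsilon> (fobj F X) \<cdot>\<^bsub>B\<^esub> \<delta> X)"

definition gamma ::
    "('o, 'm) cat \<Rightarrow> ('o, 'm, 'o, 'm) func \<Rightarrow> ('o \<Rightarrow> 'm) \<Rightarrow> ('o \<Rightarrow> 'm) \<Rightarrow> 'o \<Rightarrow> 'm" where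
  "gamma B F \<delta> \<epsilon> X = \<epsilon> (fobj F X) \<cdot>\<^bsub>B\<^esub> \<delta> X"

definition frobenius_property ::
    "('o, 'm) cat \<Rightarrow> ('o, 'm, 'o, 'm) func \<Rightarrow> ('o \<Rightarrow> 'm) \<Rightarrow> ('o \<Rightarrow> 'm) \<Rightarrow> bool" where
  "frobenius_property B F m \<delta> \<longleftrightarrow>
     (\<forall>X\<in>Obj B.
        farr F (m X) \<cdot>\<^bsub>B\<^esub> \<delta> (fobj F X) = \<delta> X \<cdot>\<^bsub>B\<^esub> m X \<and>
        \<delta> X \<cdot>\<^bsub>B\<^esub> m X = m (fobj F X) \<cdot>\<^bsub>B\<^esub> farr F (\<delta> X))"


section \<open>Modules, comodules, Frobenius bimodules\<close>

definition is_module ::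
    "('o, 'm) cat \<Rightarrow> ('o, 'm, 'o, 'm) func \<Rightarrow> ('o \<Rightarrow> 'm) \<Rightarrow> 'o \<times> 'm \<Rightarrow> bool" where
  "is_module B F m = (\<lambda>(X, \<rho>).
     X \<in> Obj B \<and> \<rho> \<in> hom B (fobj F X) X \<and>
     \<rho> \<cdot>\<^bsub>B\<^esub> farr F \<rho> = \<rho> \<cdot>\<^bsub>B\<^esub> m X)"

definition is_comodule ::
    "('o, 'm) cat \<Rightarrow> ('o, 'm, 'o, 'm) func \<Rightarrow> ('o \<Rightarrow> 'm) \<Rightarrow> 'o \<times> 'm \<Rightarrow> bool" where
  "is_comodule B F \<delta> = (\<lambda>(X, \<omega>).
     X \<in> Obj B \<and> \<omega> \<in> hom B X (fobj F X) \<and>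
     farr F \<omega> \<cdot>\<^bsub>B\<^esub> \<omega> = \<delta> X \<cdot>\<^bsub>B\<^esub> \<omega>)"

definition module_hom ::
    "('o, 'm) cat \<Rightarrow> ('o, 'm, 'o, 'm) func \<Rightarrow> 'o \<times> 'm \<Rightarrow> 'o \<times> 'm \<Rightarrow> 'm \<Rightarrow> bool" where
  "module_hom B F = (\<lambda>(X, \<rho>) (X', \<rho>') h.
     h \<in> hom B X X' \<and> h \<cdot>\<^bsub>B\<^esub> \<rho> = \<rho>' \<cdot>\<^bsub>B\<^esub> farr F h)"

definition comodule_hom ::
    "('o, 'm) cat \<Rightarrow> ('o, 'm, 'o, 'm) func \<Rightarrow> 'o \<times> 'm \<Rightarrow> 'o \<times> 'm \<Rightarrow> 'm \<Rightarrow> bool" where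
  "comodule_hom B F = (\<lambda>(X, \<omega>) (X', \<omega>') h.
     h \<in> hom B X X' \<and> farr F h \<cdot>\<^bsub>B\<^esub> \<omega> = \<omega>' \<cdot>\<^bsub>B\<^esub> h)"

definition gamma_compatible ::
    "('o, 'm) cat \<Rightarrow> ('o, 'm, 'o, 'm) func \<Rightarrow> ('o \<Rightarrow> 'm) \<Rightarrow> ('o \<Rightarrow> 'm) \<Rightarrow> 'o \<times> 'm \<Rightarrow> bool" where
  "gamma_compatible B F \<delta> \<epsilon> = (\<lambda>(X, \<omega>). gamma B F \<delta> \<epsilon> X \<cdot>\<^bsub>B\<^esub> \<omega> = \<omega>)"

text \<open>\<open>h\<close> is a morphism with domain the comodule \<open>(X, \<omega>)\<close>; the codomain does not enter the
  condition.\<close>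

definition gamma_compatible_hom ::
    "('o, 'm) cat \<Rightarrow> ('o \<Rightarrow> 'm) \<Rightarrow> 'o \<times> 'm \<Rightarrow> 'm \<Rightarrow> bool" where
  "gamma_compatible_hom B \<epsilon> = (\<lambda>(X, \<omega>) h. h \<cdot>\<^bsub>B\<^esub> \<epsilon> X \<cdot>\<^bsub>B\<^esub> \<omega> = h)"

definition frobenius_bimodule ::
    "('o, 'm) cat \<Rightarrow> ('o, 'm, 'o, 'm) func \<Rightarrow> ('o \<Rightarrow> 'm) \<Rightarrow> ('o \<Rightarrow> 'm) \<Rightarrow> 'o \<times> 'm \<times> 'm \<Rightarrow> bool" where
  "frobenius_bimodule B F m \<delta> = (\<lambda>(X, \<rho>, \<omega>).
     is_module B F m (X, \<rho>) \<and> is_comodule B F \<delta> (X, \<omega>) \<and>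
     farr F \<rho> \<cdot>\<^bsub>B\<^esub> \<delta> X = \<omega> \<cdot>\<^bsub>B\<^esub> \<rho> \<and>
     \<omega> \<cdot>\<^bsub>B\<^esub> \<rho> = m X \<cdot>\<^bsub>B\<^esub> farr F \<omega>)"

definition frobenius_bimodule_hom ::
    "('o, 'm) cat \<Rightarrow> ('o, 'm, 'o, 'm) func \<Rightarrow> 'o \<times> 'm \<times> 'm \<Rightarrow> 'o \<times> 'm \<times> 'm \<Rightarrow> 'm \<Rightarrow> bool" where
  "frobenius_bimodule_hom B F = (\<lambda>(X, \<rho>, \<omega>) (X', \<rho>', \<omega>') h.
     module_hom B F (X, \<rho>) (X', \<rho>') h \<and> comodule_hom B F (X, \<omega>) (X', \<omega>') h)"

definition compat_frobenius_action ::
    "('o, 'm) cat \<Rightarrow> ('o, 'm, 'o, 'm) func \<Rightarrow> ('o \<Rightarrow> 'm) \<Rightarrow> ('o \<Rightarrow> 'm) \<Rightarrow> ('o \<Rightarrow> 'm)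
      \<Rightarrow> 'o \<times> 'm \<Rightarrow> 'm \<Rightarrow> bool" where
  "compat_frobenius_action B F m \<delta> \<epsilon> = (\<lambda>(X, \<omega>) \<rho>.
     comodule_hom B F (fobj F X, \<delta> X) (X, \<omega>) \<rho> \<and>
     gamma_compatible_hom B \<epsilon> (fobj F X, \<delta> X) \<rho> \<and>
     frobenius_bimodule B F m \<delta> (X, \<rho>, \<omega>))"

definition induced_action ::
    "('o, 'm) cat \<Rightarrow> ('o, 'm, 'o, 'm) func \<Rightarrow> ('o \<Rightarrow> 'm) \<Rightarrow> ('o \<Rightarrow> 'm) \<Rightarrow> 'o \<times> 'm \<Rightarrow> 'm" where
  "induced_action B F m \<epsilon> = (\<lambda>(X, \<omega>). \<epsilon> X \<cdot>\<^bsub>B\<^esub> m X \<cdot>\<^bsub>B\<^esub> farr F \<omega>)"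


section \<open>Categories of comodules and bimodules\<close>

text \<open>An arrow is a triple (domain, underlying morphism, codomain), since one morphism of the
  base category may be a structure-preserving map for several structures.\<close>

definition structured_cat ::
    "('o, 'm) cat \<Rightarrow> 's set \<Rightarrow> ('s \<Rightarrow> 'o) \<Rightarrow> ('s \<Rightarrow> 's \<Rightarrow> 'm \<Rightarrow> bool)
      \<Rightarrow> ('s, 's \<times> 'm \<times> 's) cat" where
  "structured_cat B S u H =
     \<lparr>Obj = S,
      Arr = {(s, h, t) | s h t. s \<in> S \<and> t \<in> S \<and> H s t h},
      Dom = (\<lambda>(s, h, t). s),
      Cod = (\<lambda>(s, h, t). t),
      Id = (\<lambda>s. (s, Id B (u s), s)),
      Comp = (\<lambda>(s', h', t') (s, h, t). (s, h' \<cdot>\<^bsub>B\<^esub> h, t'))\<rparr>"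

definition comodule_cat ::
    "('o, 'm) cat \<Rightarrow> ('o, 'm, 'o, 'm) func \<Rightarrow> ('o \<Rightarrow> 'm)
      \<Rightarrow> ('o \<times> 'm, ('o \<times> 'm) \<times> 'm \<times> ('o \<times> 'm)) cat" where
  "comodule_cat B F \<delta> =
     structured_cat B {M. is_comodule B F \<delta> M} (\<lambda>(X, \<omega>). X) (comodule_hom B F)"

definition frobenius_cat ::
    "('o, 'm) cat \<Rightarrow> ('o, 'm, 'o, 'm) func \<Rightarrow> ('o \<Rightarrow> 'm) \<Rightarrow> ('o \<Rightarrow> 'm)
      \<Rightarrow> ('o \<times> 'm \<times> 'm, ('o \<times> 'm \<times> 'm) \<times> 'm \<times> ('o \<times> 'm \<times> 'm)) cat" where
  "frobenius_cat B F m \<delta> =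
     structured_cat B {M. frobenius_bimodule B F m \<delta> M} (\<lambda>(X, \<rho>, \<omega>). X)
       (frobenius_bimodule_hom B F)"

definition compat_comodule_cat ::
    "('o, 'm) cat \<Rightarrow> ('o, 'm, 'o, 'm) func \<Rightarrow> ('o \<Rightarrow> 'm) \<Rightarrow> ('o \<Rightarrow> 'm)
      \<Rightarrow> ('o \<times> 'm, ('o \<times> 'm) \<times> 'm \<times> ('o \<times> 'm)) cat" where
  "compat_comodule_cat B F \<delta> \<epsilon> =
     full_subcat (comodule_cat B F \<delta>) (gamma_compatible B F \<delta> \<epsilon>)"

definition compat_frobenius_cat ::
    "('o, 'm) cat \<Rightarrow> ('o, 'm, 'o, 'm) func \<Rightarrow> ('o \<Rightarrow> 'm) \<Rightarrow> ('o \<Rightarrow> 'm) \<Rightarrow> ('o \<Rightarrow> 'm)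
      \<Rightarrow> ('o \<times> 'm \<times> 'm, ('o \<times> 'm \<times> 'm) \<times> 'm \<times> ('o \<times> 'm \<times> 'm)) cat" where
  "compat_frobenius_cat B F m \<delta> \<epsilon> =
     full_subcat (frobenius_cat B F m \<delta>) (\<lambda>(X, \<rho>, \<omega>). gamma_compatible B F \<delta> \<epsilon> (X, \<omega>))"

text \<open>Compatibility of \<open>(X, \<omega>)\<close> alone does not force the action \<open>\<rho>\<close> to be a
  \<open>\<gamma>\<close>-compatible comodule morphism out of \<open>(F X, \<delta> X)\<close>, and without that \<open>\<rho>\<close> is not determined
  by \<open>\<omega>\<close>: if \<open>F\<close> is the identity functor of a category with zero morphisms and
  \<open>m\<close>, \<open>\<delta>\<close>, \<open>\<epsilon>\<close> are all zero, every \<open>(X, \<rho>, 0)\<close> with \<open>\<rho> \<cdot> \<rho> = 0\<close> is a Frobenius bimodule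
  with compatible \<open>(X, 0)\<close>. Hence \<open>Psi\<close> is not invertible on all of
  \<open>compat_frobenius_cat\<close>. The following full subcategory imposes the missing condition on \<open>\<rho>\<close>.\<close>

definition compat_action_frobenius_cat ::
    "('o, 'm) cat \<Rightarrow> ('o, 'm, 'o, 'm) func \<Rightarrow> ('o \<Rightarrow> 'm) \<Rightarrow> ('o \<Rightarrow> 'm) \<Rightarrow> ('o \<Rightarrow> 'm)
      \<Rightarrow> ('o \<times> 'm \<times> 'm, ('o \<times> 'm \<times> 'm) \<times> 'm \<times> ('o \<times> 'm \<times> 'm)) cat" where
  "compat_action_frobenius_cat B F m \<delta> \<epsilon> =
     full_subcat (compat_frobenius_cat B F m \<delta> \<epsilon>)
       (\<lambda>(X, \<rho>, \<omega>). gamma_compatible_hom B \<epsilon> (fobj F X, \<delta> X) \<rho>)"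

definition add_action ::
    "('o, 'm) cat \<Rightarrow> ('o, 'm, 'o, 'm) func \<Rightarrow> ('o \<Rightarrow> 'm) \<Rightarrow> ('o \<Rightarrow> 'm)
      \<Rightarrow> 'o \<times> 'm \<Rightarrow> 'o \<times> 'm \<times> 'm" where
  "add_action B F m \<epsilon> = (\<lambda>(X, \<omega>). (X, induced_action B F m \<epsilon> (X, \<omega>), \<omega>))"

definition Psi ::
    "('o, 'm) cat \<Rightarrow> ('o, 'm, 'o, 'm) func \<Rightarrow> ('o \<Rightarrow> 'm) \<Rightarrow> ('o \<Rightarrow> 'm)
      \<Rightarrow> ('o \<times> 'm, ('o \<times> 'm) \<times> 'm \<times> ('o \<times> 'm),
           'o \<times> 'm \<times> 'm, ('o \<times> 'm \<times> 'm) \<times> 'm \<times> ('o \<times> 'm \<times> 'm)) func" where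
  "Psi B F m \<epsilon> =
     \<lparr>fobj = add_action B F m \<epsilon>,
      farr = (\<lambda>(M, h, N). (add_action B F m \<epsilon> M, h, add_action B F m \<epsilon> N))\<rparr>"

definition forget_action ::
    "('o \<times> 'm \<times> 'm, ('o \<times> 'm \<times> 'm) \<times> 'm \<times> ('o \<times> 'm \<times> 'm),
      'o \<times> 'm, ('o \<times> 'm) \<times> 'm \<times> ('o \<times> 'm)) func" where
  "forget_action =
     \<lparr>fobj = (\<lambda>(X, \<rho>, \<omega>). (X, \<omega>)),
      farr = (\<lambda>((X, \<rho>, \<omega>), h, (X', \<rho>', \<omega>')). ((X, \<omega>), h, (X', \<omega>')))\<rparr>"

end

theory Submission
  imports Defs
begin

text \<open>For a comodule \<open>(X, \<omega>)\<close>, the Frobenius property and \<open>m = \<gamma> \<cdot> m\<close> show that the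
  induced action \<open>\<rho>\<close> satisfies \<open>\<omega> \<cdot> \<rho> = m X \<cdot> F \<omega> = F \<rho> \<cdot> \<delta> X\<close>; associativity and compatibility
  of \<open>\<rho>\<close> follow from this. Conversely a compatible action is recovered from \<open>\<omega>\<close>, because
  \<open>\<rho> = \<rho> \<cdot> \<epsilon> F \<cdot> \<delta> = \<epsilon> \<cdot> F \<rho> \<cdot> \<delta> = \<epsilon> \<cdot> m \<cdot> F \<omega>\<close>. On morphisms nothing happens: all the categories
  involved are concrete over \<open>B\<close>, and the functors keep underlying morphisms.\<close>

section \<open>Concrete categories\<close>

lemma homD:
  assumes "f \<in> hom C X Y"
  shows "f \<in> Arr C" "Dom C f = X" "Cod C f = Y"
  using assms by (auto simp: hom_def)

lemma homI: "\<lbrakk>f \<in> Arr C; Dom C f = X; Cod C f = Y\<rbrakk> \<Longrightarrow> f \<in> hom C X Y"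
  by (simp add: hom_def)

context category
begin

text \<open>In the \<open>hom\<close> form of the axioms the intermediate objects occur only in the
  premises, so they do not work well as rewrite rules. The versions over \<open>Arr\<close> have
  side conditions on \<open>Dom\<close> and \<open>Cod\<close> that \<open>simp\<close> can
  discharge by itself.\<close>

lemma Comp_simps:
  assumes "f \<in> Arr C" "g \<in> Arr C" "Cod C f = Dom C g"
  shows "g \<cdot> f \<in> Arr C" "Dom C (g \<cdot> f) = Dom C f" "Cod C (g \<cdot> f) = Cod C g"
  using Comp_hom[of f "Dom C f" "Dom C g" g "Cod C g"] assms by (auto simp: hom_def)

lemma Comp_assoc_Arr:
  assumes "f \<in> Arr C" "g \<in> Arr C" "h \<in> Arr C" "Cod C f = Dom C g" "Cod C g = Dom C h"
  shows "(h \<cdot> g) \<cdot> f = h \<cdot> (g \<cdot> f)"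
  using Comp_assoc[of f "Dom C f" "Dom C g" g "Dom C h" h "Cod C h"] assms
  by (auto simp: hom_def)

end

text \<open>Structures \<open>s\<close> lie over base objects \<open>u s\<close>, and
  \<open>H\<close> selects the base morphisms that preserve structure. The assumptions are what
  \<open>structured_cat\<close> needs to be a category with a faithful forgetful functor to
  \<open>B\<close>.\<close>

locale concrete_over = category B for B :: "('o, 'm) cat" (structure) +
  fixes S :: "'s set" and u :: "'s \<Rightarrow> 'o" and H :: "'s \<Rightarrow> 's \<Rightarrow> 'm \<Rightarrow> bool"
  assumes H_hom: "\<lbrakk>s \<in> S; t \<in> S; H s t h\<rbrakk> \<Longrightarrow> h \<in> hom B (u s) (u t)"
    and H_Id: "s \<in> S \<Longrightarrow> H s s (Id B (u s))"
    and H_Comp: "\<lbrakk>r \<in> S; s \<in> S; t \<in> S; H r s f; H s t g\<rbrakk> \<Longrightarrow> H r t (g \<cdot> f)"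

lemma hom_structured_cat:
  "hom (structured_cat B S u H) s t = {(s, h, t) | h. s \<in> S \<and> t \<in> S \<and> H s t h}"
  by (auto simp: hom_def structured_cat_def)

text \<open>Arrows compose through their middle component, so every law is inherited from
  \<open>B\<close>.\<close>

lemma (in concrete_over) category_structured_cat: "category (structured_cat B S u H)"
proof
  fix f assume "f \<in> Arr (structured_cat B S u H)"
  then show "Dom (structured_cat B S u H) f \<in> Obj (structured_cat B S u H)"
    "Cod (structured_cat B S u H) f \<in> Obj (structured_cat B S u H)"
    by (auto simp: structured_cat_def)
next
  fix X assume "X \<in> Obj (structured_cat B S u H)"
  then show "Id (structured_cat B S u H) X \<in> hom (structured_cat B S u H) X X"
    unfolding hom_structured_cat by (auto simp: structured_cat_def H_Id)
next
  fix f g X Y Z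
  assume "f \<in> hom (structured_cat B S u H) X Y" "g \<in> hom (structured_cat B S u H) Y Z"
  then show "g \<cdot>\<^bsub>structured_cat B S u H\<^esub> f \<in> hom (structured_cat B S u H) X Z"
    unfolding hom_structured_cat using H_Comp by (fastforce simp: structured_cat_def)
next
  fix f X Y
  assume "f \<in> hom (structured_cat B S u H) X Y"
  then show "Id (structured_cat B S u H) Y \<cdot>\<^bsub>structured_cat B S u H\<^esub> f = f"
    "f \<cdot>\<^bsub>structured_cat B S u H\<^esub> Id (structured_cat B S u H) X = f"
    unfolding hom_structured_cat
    by (auto simp: structured_cat_def intro!: Id_left Id_right H_hom)
next
  fix f g h W X Y Z
  assume "f \<in> hom (structured_cat B S u H) W X" "g \<in> hom (structured_cat B S u H) X Y"
    "h \<in> hom (structured_cat B S u H) Y Z"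
  then show "(h \<cdot>\<^bsub>structured_cat B S u H\<^esub> g) \<cdot>\<^bsub>structured_cat B S u H\<^esub> f
      = h \<cdot>\<^bsub>structured_cat B S u H\<^esub> (g \<cdot>\<^bsub>structured_cat B S u H\<^esub> f)"
    unfolding hom_structured_cat
    by (auto simp: structured_cat_def intro!: Comp_assoc H_hom)
qed

text \<open>Passing to a full subcategory only shrinks the set of structures, so all categories of
  the theorem fall under one construction.\<close>

lemma full_subcat_structured_cat:
  "full_subcat (structured_cat B S u H) P = structured_cat B {s \<in> S. P s} u H"
  by (auto simp: full_subcat_def structured_cat_def)

definition over_func :: "('s \<Rightarrow> 't) \<Rightarrow> ('s, 's \<times> 'm \<times> 's, 't, 't \<times> 'm \<times> 't) func" where
  "over_func \<phi> = \<lparr>fobj = \<phi>, farr = (\<lambda>(s, h, t). (\<phi> s, h, \<phi> t))\<rparr>"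

text \<open>Composites are preserved because the middle component is untouched; identities are
  preserved because \<open>\<phi>\<close> keeps the underlying object.\<close>

lemma is_functor_over_func:
  assumes S: "concrete_over B S u H" and T: "concrete_over B T v K"
    and \<phi>: "\<And>s. s \<in> S \<Longrightarrow> \<phi> s \<in> T" "\<And>s. s \<in> S \<Longrightarrow> v (\<phi> s) = u s"
    and H_K: "\<And>s t h. \<lbrakk>s \<in> S; t \<in> S; H s t h\<rbrakk> \<Longrightarrow> K (\<phi> s) (\<phi> t) h"
  shows "is_functor (structured_cat B S u H) (structured_cat B T v K) (over_func \<phi>)"
proof (intro is_functor.intro is_functor_axioms.intro)
  show "category (structured_cat B S u H)" "category (structured_cat B T v K)"
    using S T by (simp_all add: concrete_over.category_structured_cat)
next
  fix X assume "X \<in> Obj (structured_cat B S u H)"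
  then show "fobj (over_func \<phi>) X \<in> Obj (structured_cat B T v K)"
    "farr (over_func \<phi>) (Id (structured_cat B S u H) X)
      = Id (structured_cat B T v K) (fobj (over_func \<phi>) X)"
    using \<phi> by (auto simp: structured_cat_def over_func_def)
next
  fix f X Y assume "f \<in> hom (structured_cat B S u H) X Y"
  then show "farr (over_func \<phi>) f
      \<in> hom (structured_cat B T v K) (fobj (over_func \<phi>) X) (fobj (over_func \<phi>) Y)"
    unfolding hom_structured_cat using \<phi> H_K by (auto simp: over_func_def)
next
  fix f g X Y Z
  assume "f \<in> hom (structured_cat B S u H) X Y" "g \<in> hom (structured_cat B S u H) Y Z"
  then show "farr (over_func \<phi>) (g \<cdot>\<^bsub>structured_cat B S u H\<^esub> f)
      = farr (over_func \<phi>) g \<cdot>\<^bsub>structured_cat B T v K\<^esub> farr (over_func \<phi>) f"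
    unfolding hom_structured_cat by (auto simp: structured_cat_def over_func_def)
qed

text \<open>Since underlying morphisms are kept, an inverse on structures is automatically one on
  arrows.\<close>

lemma func_agree_over_func:
  assumes "\<And>s. s \<in> S \<Longrightarrow> \<psi> (\<phi> s) = s"
  shows "func_agree (structured_cat B S u H) (comp_func (over_func \<psi>) (over_func \<phi>)) id_func"
  using assms
  by (auto simp: func_agree_def comp_func_def id_func_def over_func_def structured_cat_def)

lemma Psi_eq_over_func: "Psi B F m \<epsilon> = over_func (add_action B F m \<epsilon>)"
  by (simp add: Psi_def over_func_def)

lemma forget_action_eq_over_func: "forget_action = over_func (\<lambda>(X, \<rho>, \<omega>). (X, \<omega>))"
  by (auto simp: forget_action_def over_func_def fun_eq_iff)


section \<open>Actions on compatible comodules\<close>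

context is_functor
begin

lemma farr_simps:
  assumes "f \<in> Arr C"
  shows "farr F f \<in> Arr D" "Dom D (farr F f) = fobj F (Dom C f)"
    "Cod D (farr F f) = fobj F (Cod C f)"
  using farr_hom[of f "Dom C f" "Cod C f"] assms by (auto simp: hom_def)

lemma farr_Comp_Arr:
  "\<lbrakk>f \<in> Arr C; g \<in> Arr C; Cod C f = Dom C g\<rbrakk> \<Longrightarrow> farr F (g \<cdot>\<^bsub>C\<^esub> f) = farr F g \<cdot>\<^bsub>D\<^esub> farr F f"
  using farr_Comp[of f "Dom C f" "Dom C g" g "Cod C g"] by (auto simp: hom_def)

end

section \<open>Identities and composites of module and comodule morphisms\<close>

lemma comodule_hom_hom: "comodule_hom B F M N h \<Longrightarrow> h \<in> hom B (fst M) (fst N)"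
  by (auto simp: comodule_hom_def split: prod.splits)

locale endofunctor = is_functor B B F
  for B :: "('o, 'm) cat" (structure) and F :: "('o, 'm, 'o, 'm) func"
begin

text \<open>These rules nest composites to the right and distribute \<open>F\<close> over them. The
  calculations below therefore bracket the factor to be replaced, rewrite it by
  \<open>unfolding\<close>, and then renormalise.\<close>

lemmas arrow_simps =
  source.Comp_simps source.Comp_assoc_Arr farr_simps farr_Comp_Arr fobj_Obj

lemma comodule_hom_Id: "is_comodule B F \<delta> M \<Longrightarrow> comodule_hom B F M M (Id B (fst M))"
  by (auto simp: is_comodule_def comodule_hom_def source.Id_hom farr_Id
      source.Id_left source.Id_right)

lemma module_hom_Id: "is_module B F m M \<Longrightarrow> module_hom B F M M (Id B (fst M))"
  by (auto simp: is_module_def module_hom_def source.Id_hom farr_Id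
      source.Id_left source.Id_right)

text \<open>The squares of \<open>f\<close> and \<open>g\<close> are pasted along
  \<open>\<omega>'\<close>; functoriality of \<open>F\<close> identifies the outer edge.\<close>

lemma comodule_hom_Comp:
  assumes L: "is_comodule B F \<delta> L" and M: "is_comodule B F \<delta> M" and N: "is_comodule B F \<delta> N"
    and f: "comodule_hom B F L M f" and g: "comodule_hom B F M N g"
  shows "comodule_hom B F L N (g \<cdot> f)"
proof -
  obtain X \<omega> Y \<omega>' Z \<omega>'' where eqs: "L = (X, \<omega>)" "M = (Y, \<omega>')" "N = (Z, \<omega>'')"
    by (metis surj_pair)
  have \<omega>: "\<omega> \<in> hom B X (fobj F X)" "\<omega>' \<in> hom B Y (fobj F Y)" "\<omega>'' \<in> hom B Z (fobj F Z)"
    using L M N by (auto simp: eqs is_comodule_def)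
  have h: "f \<in> hom B X Y" "g \<in> hom B Y Z"
    and fc: "farr F f \<cdot> \<omega> = \<omega>' \<cdot> f" and gc: "farr F g \<cdot> \<omega>' = \<omega>'' \<cdot> g"
    using f g by (auto simp: eqs comodule_hom_def)
  note s = \<omega>[THEN homD(1)] \<omega>[THEN homD(2)] \<omega>[THEN homD(3)]
    h[THEN homD(1)] h[THEN homD(2)] h[THEN homD(3)] arrow_simps
  have "farr F (g \<cdot> f) \<cdot> \<omega> = farr F g \<cdot> (farr F f \<cdot> \<omega>)" by (simp add: s)
  also have "\<dots> = (farr F g \<cdot> \<omega>') \<cdot> f" unfolding fc by (simp add: s)
  also have "\<dots> = \<omega>'' \<cdot> (g \<cdot> f)" unfolding gc by (simp add: s)
  finally show ?thesis using h by (simp add: eqs comodule_hom_def source.Comp_hom)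
qed

lemma module_hom_Comp:
  assumes L: "is_module B F m L" and M: "is_module B F m M" and N: "is_module B F m N"
    and f: "module_hom B F L M f" and g: "module_hom B F M N g"
  shows "module_hom B F L N (g \<cdot> f)"
proof -
  obtain X \<rho> Y \<rho>' Z \<rho>'' where eqs: "L = (X, \<rho>)" "M = (Y, \<rho>')" "N = (Z, \<rho>'')"
    by (metis surj_pair)
  have \<rho>: "\<rho> \<in> hom B (fobj F X) X" "\<rho>' \<in> hom B (fobj F Y) Y" "\<rho>'' \<in> hom B (fobj F Z) Z"
    using L M N by (auto simp: eqs is_module_def)
  have h: "f \<in> hom B X Y" "g \<in> hom B Y Z"
    and fc: "f \<cdot> \<rho> = \<rho>' \<cdot> farr F f" and gc: "g \<cdot> \<rho>' = \<rho>'' \<cdot> farr F g"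
    using f g by (auto simp: eqs module_hom_def)
  note s = \<rho>[THEN homD(1)] \<rho>[THEN homD(2)] \<rho>[THEN homD(3)]
    h[THEN homD(1)] h[THEN homD(2)] h[THEN homD(3)] arrow_simps
  have "(g \<cdot> f) \<cdot> \<rho> = g \<cdot> (f \<cdot> \<rho>)" by (simp add: s)
  also have "\<dots> = (g \<cdot> \<rho>') \<cdot> farr F f" unfolding fc by (simp add: s)
  also have "\<dots> = \<rho>'' \<cdot> farr F (g \<cdot> f)" unfolding gc by (simp add: s)
  finally show ?thesis using h by (simp add: eqs module_hom_def source.Comp_hom)
qed

text \<open>The free predicate \<open>P\<close> leaves room for the compatibility conditions that
  cut out full subcategories.\<close>

lemma concrete_over_comodules:
  "concrete_over B {M. is_comodule B F \<delta> M \<and> P M} (\<lambda>(X, \<omega>). X) (comodule_hom B F)"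
  by unfold_locales
    (auto dest: comodule_hom_hom comodule_hom_Id intro: comodule_hom_Comp)

lemma concrete_over_bimodules:
  "concrete_over B {M. frobenius_bimodule B F m \<delta> M \<and> P M} (\<lambda>(X, \<rho>, \<omega>). X)
     (frobenius_bimodule_hom B F)"
  by unfold_locales
    (auto simp: frobenius_bimodule_def frobenius_bimodule_hom_def
      dest: comodule_hom_hom comodule_hom_Id module_hom_Id
      intro: comodule_hom_Comp module_hom_Comp)

end

section \<open>The Frobenius setting and the induced action\<close>

locale weak_frobenius_functor = endofunctor +
  fixes m \<delta> \<epsilon> :: "'a \<Rightarrow> 'b"
  assumes monad: "nonunital_monad B F m"
    and frobenius: "frobenius_property B F m \<delta>"
    and weak: "weak_comonad B F \<delta> \<epsilon>"
    and gamma_m: "X \<in> Obj B \<Longrightarrow> gamma B F \<delta> \<epsilon> X \<cdot> m X = m X"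
begin

lemma component_hom:
  assumes "X \<in> Obj B"
  shows "m X \<in> hom B (fobj F (fobj F X)) (fobj F X)"
    "\<delta> X \<in> hom B (fobj F X) (fobj F (fobj F X))"
    "\<epsilon> X \<in> hom B (fobj F X) X"
  using monad weak assms
  by (auto simp: nonunital_monad_def weak_comonad_def noncounital_comonad_def nat_trans_def
      comp_func_def id_func_def)

lemmas component_simps = component_hom[THEN homD(1)] component_hom[THEN homD(2)]
  component_hom[THEN homD(3)] arrow_simps

lemma naturality:
  assumes "f \<in> hom B X Y"
  shows "farr F f \<cdot> m X = m Y \<cdot> farr F (farr F f)"
    "farr F (farr F f) \<cdot> \<delta> X = \<delta> Y \<cdot> farr F f"
    "f \<cdot> \<epsilon> X = \<epsilon> Y \<cdot> farr F f"
  using monad weak assms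
  by (auto simp: nonunital_monad_def weak_comonad_def noncounital_comonad_def nat_trans_def
      comp_func_def id_func_def hom_def)

text \<open>The last two equations are both \<open>\<gamma> \<cdot> m = m\<close>: the weak comonad
  law identifies the two descriptions \<open>\<epsilon> F \<cdot> \<delta>\<close> and
  \<open>F \<epsilon> \<cdot> \<delta>\<close> of \<open>\<gamma>\<close>, and each is needed for
  one of the two Frobenius equations of a bimodule.\<close>

lemma structure_eqs:
  assumes "X \<in> Obj B"
  shows "m X \<cdot> farr F (m X) = m X \<cdot> m (fobj F X)"
    "farr F (m X) \<cdot> \<delta> (fobj F X) = \<delta> X \<cdot> m X"
    "m (fobj F X) \<cdot> farr F (\<delta> X) = \<delta> X \<cdot> m X"
    "\<epsilon> (fobj F X) \<cdot> \<delta> X \<cdot> m X = m X"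
    "farr F (\<epsilon> X) \<cdot> \<delta> X \<cdot> m X = m X"
proof -
  show "m X \<cdot> farr F (m X) = m X \<cdot> m (fobj F X)"
    using monad assms by (simp add: nonunital_monad_def)
  show "farr F (m X) \<cdot> \<delta> (fobj F X) = \<delta> X \<cdot> m X" "m (fobj F X) \<cdot> farr F (\<delta> X) = \<delta> X \<cdot> m X"
    using frobenius assms by (simp_all add: frobenius_property_def)
  have \<gamma>: "farr F (\<epsilon> X) \<cdot> \<delta> X = \<epsilon> (fobj F X) \<cdot> \<delta> X"
    using weak assms by (simp add: weak_comonad_def)
  show e: "\<epsilon> (fobj F X) \<cdot> \<delta> X \<cdot> m X = m X"
    using gamma_m[OF assms] assms by (simp add: gamma_def component_simps)
  have "farr F (\<epsilon> X) \<cdot> \<delta> X \<cdot> m X = (farr F (\<epsilon> X) \<cdot> \<delta> X) \<cdot> m X"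
    using assms by (simp add: component_simps)
  then show "farr F (\<epsilon> X) \<cdot> \<delta> X \<cdot> m X = m X"
    unfolding \<gamma> using assms e by (simp add: component_simps)
qed

text \<open>Naturality of \<open>\<epsilon>\<close> moves it from the source of
  \<open>\<rho>\<close> to the target, and the comodule square then replaces
  \<open>F \<rho> \<cdot> \<delta> X\<close> by \<open>\<omega> \<cdot> \<rho>\<close>.\<close>

lemma comodule_hom_gamma_compatible_iff:
  assumes "is_comodule B F \<delta> (X, \<omega>)" "comodule_hom B F (fobj F X, \<delta> X) (X, \<omega>) \<rho>"
  shows "gamma_compatible_hom B \<epsilon> (fobj F X, \<delta> X) \<rho> \<longleftrightarrow> \<epsilon> X \<cdot> \<omega> \<cdot> \<rho> = \<rho>"
proof -
  have X: "X \<in> Obj B" and \<rho>: "\<rho> \<in> hom B (fobj F X) X" and c: "farr F \<rho> \<cdot> \<delta> X = \<omega> \<cdot> \<rho>"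
    using assms by (auto simp: is_comodule_def comodule_hom_def)
  note s = X homD[OF \<rho>] component_simps
  have "\<rho> \<cdot> \<epsilon> (fobj F X) \<cdot> \<delta> X = (\<rho> \<cdot> \<epsilon> (fobj F X)) \<cdot> \<delta> X" by (simp add: s)
  also have "\<dots> = \<epsilon> X \<cdot> farr F \<rho> \<cdot> \<delta> X" unfolding naturality(3)[OF \<rho>] by (simp add: s)
  finally show ?thesis by (simp add: gamma_compatible_hom_def c)
qed

text \<open>In \<open>\<epsilon> X \<cdot> \<omega> \<cdot> \<rho> = \<rho>\<close> the bimodule
  equation \<open>\<omega> \<cdot> \<rho> = m X \<cdot> F \<omega>\<close> eliminates
  \<open>\<rho>\<close> from the left-hand side.\<close>

lemma compat_frobenius_action_unique:
  assumes "compat_frobenius_action B F m \<delta> \<epsilon> (X, \<omega>) \<rho>"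
  shows "\<rho> = induced_action B F m \<epsilon> (X, \<omega>)"
proof -
  have "is_comodule B F \<delta> (X, \<omega>)" "\<omega> \<cdot> \<rho> = m X \<cdot> farr F \<omega>"
    using assms by (auto simp: compat_frobenius_action_def frobenius_bimodule_def)
  then show ?thesis
    using comodule_hom_gamma_compatible_iff assms
    by (auto simp: compat_frobenius_action_def induced_action_def)
qed

lemma compat_frobenius_action_induced_action:
  assumes M: "is_comodule B F \<delta> (X, \<omega>)"
  shows "compat_frobenius_action B F m \<delta> \<epsilon> (X, \<omega>) (induced_action B F m \<epsilon> (X, \<omega>))"
proof -
  define \<rho> where "\<rho> = \<epsilon> X \<cdot> m X \<cdot> farr F \<omega>"
  have X: "X \<in> Obj B" and \<omega>: "\<omega> \<in> hom B X (fobj F X)" and c: "farr F \<omega> \<cdot> \<omega> = \<delta> X \<cdot> \<omega>"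
    using M by (auto simp: is_comodule_def)
  note s = X homD[OF \<omega>] component_simps
  have \<rho>: "\<rho> \<in> hom B (fobj F X) X"
    unfolding \<rho>_def by (intro homI) (simp_all add: s)
  note r = homD[OF \<rho>]
  \<comment> \<open>Naturality carries \<open>\<omega>\<close> past \<open>\<epsilon>\<close> and
    \<open>m\<close>, where it meets the inner \<open>F \<omega>\<close>. Coassociativity
    \<open>c\<close> turns the pair into \<open>F (\<delta> X) \<cdot> F \<omega>\<close>, which is
    ready for the Frobenius law.\<close>
  have "\<omega> \<cdot> \<rho> = (\<omega> \<cdot> \<epsilon> X) \<cdot> m X \<cdot> farr F \<omega>" by (simp add: \<rho>_def s)
  also have "\<dots> = \<epsilon> (fobj F X) \<cdot> (farr F \<omega> \<cdot> m X) \<cdot> farr F \<omega>"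
    unfolding naturality(3)[OF \<omega>] by (simp add: s)
  also have "\<dots> = \<epsilon> (fobj F X) \<cdot> m (fobj F X) \<cdot> farr F (farr F \<omega> \<cdot> \<omega>)"
    unfolding naturality(1)[OF \<omega>] by (simp add: s)
  also have "\<dots> = \<epsilon> (fobj F X) \<cdot> (m (fobj F X) \<cdot> farr F (\<delta> X)) \<cdot> farr F \<omega>"
    unfolding c by (simp add: s)
  also have "\<dots> = (\<epsilon> (fobj F X) \<cdot> \<delta> X \<cdot> m X) \<cdot> farr F \<omega>"
    unfolding structure_eqs(3)[OF X] by (simp add: s)
  \<comment> \<open>The hypothesis \<open>m = \<gamma> \<cdot> m\<close> enters here with
    \<open>\<gamma>\<close> in the form \<open>\<epsilon> F \<cdot> \<delta>\<close>.\<close>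
  finally have \<omega>\<rho>: "\<omega> \<cdot> \<rho> = m X \<cdot> farr F \<omega>" unfolding structure_eqs(4)[OF X] .
  \<comment> \<open>The other half of the Frobenius law is used now, with \<open>\<gamma>\<close> in
    the form \<open>F \<epsilon> \<cdot> \<delta>\<close>.\<close>
  have "farr F \<rho> \<cdot> \<delta> X = farr F (\<epsilon> X) \<cdot> farr F (m X) \<cdot> (farr F (farr F \<omega>) \<cdot> \<delta> X)"
    by (simp add: \<rho>_def s)
  also have "\<dots> = farr F (\<epsilon> X) \<cdot> (farr F (m X) \<cdot> \<delta> (fobj F X)) \<cdot> farr F \<omega>"
    unfolding naturality(2)[OF \<omega>] by (simp add: s)
  also have "\<dots> = (farr F (\<epsilon> X) \<cdot> \<delta> X \<cdot> m X) \<cdot> farr F \<omega>"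
    unfolding structure_eqs(2)[OF X] by (simp add: s)
  finally have F\<rho>: "farr F \<rho> \<cdot> \<delta> X = m X \<cdot> farr F \<omega>" unfolding structure_eqs(5)[OF X] .
  \<comment> \<open>Expanding only the outer \<open>\<rho>\<close> exposes
    \<open>F (\<omega> \<cdot> \<rho>)\<close>, to which \<open>\<omega>\<rho>\<close> applies;
    associativity and naturality of \<open>m\<close> do the rest.\<close>
  have "\<rho> \<cdot> farr F \<rho> = \<epsilon> X \<cdot> m X \<cdot> farr F (\<omega> \<cdot> \<rho>)"
    unfolding \<rho>_def by (simp add: s)
  also have "\<dots> = \<epsilon> X \<cdot> (m X \<cdot> farr F (m X)) \<cdot> farr F (farr F \<omega>)"
    unfolding \<omega>\<rho> by (simp add: s)
  also have "\<dots> = \<epsilon> X \<cdot> m X \<cdot> (m (fobj F X) \<cdot> farr F (farr F \<omega>))"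
    unfolding structure_eqs(1)[OF X] by (simp add: s)
  also have "\<dots> = \<rho> \<cdot> m X"
    unfolding naturality(1)[OF \<omega>, symmetric] by (simp add: s \<rho>_def)
  finally have "is_module B F m (X, \<rho>)" using X \<rho> by (simp add: is_module_def)
  moreover have "comodule_hom B F (fobj F X, \<delta> X) (X, \<omega>) \<rho>"
    using \<rho> F\<rho> \<omega>\<rho> by (simp add: comodule_hom_def)
  \<comment> \<open>By \<open>\<omega>\<rho>\<close> the left-hand side becomes the defining formula
    of \<open>\<rho>\<close>; this yields compatibility of the action.\<close>
  moreover have "\<epsilon> X \<cdot> \<omega> \<cdot> \<rho> = \<rho>" unfolding \<omega>\<rho> by (simp add: \<rho>_def)
  ultimately show ?thesis
    using M F\<rho> \<omega>\<rho> comodule_hom_gamma_compatible_iff[OF M]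
    by (simp add: compat_frobenius_action_def frobenius_bimodule_def induced_action_def
        flip: \<rho>_def)
qed

text \<open>The induced action is built from \<open>\<epsilon>\<close>, \<open>m\<close> and
  \<open>F \<omega>\<close>; \<open>h\<close> passes the first two by naturality and the third
  because it is a comodule morphism.\<close>

lemma frobenius_bimodule_hom_induced_action:
  assumes M: "is_comodule B F \<delta> (X, \<omega>)" and N: "is_comodule B F \<delta> (X', \<omega>')"
    and h: "comodule_hom B F (X, \<omega>) (X', \<omega>') h"
  shows "frobenius_bimodule_hom B F (X, induced_action B F m \<epsilon> (X, \<omega>), \<omega>)
    (X', induced_action B F m \<epsilon> (X', \<omega>'), \<omega>') h"
proof -
  have X: "X \<in> Obj B" "X' \<in> Obj B"
    and \<omega>: "\<omega> \<in> hom B X (fobj F X)" "\<omega>' \<in> hom B X' (fobj F X')"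
    and hom: "h \<in> hom B X X'" and c: "farr F h \<cdot> \<omega> = \<omega>' \<cdot> h"
    using M N h by (auto simp: is_comodule_def comodule_hom_def)
  note s = X homD[OF \<omega>(1)] homD[OF \<omega>(2)] homD[OF hom] component_simps
  have "h \<cdot> \<epsilon> X \<cdot> m X \<cdot> farr F \<omega> = (h \<cdot> \<epsilon> X) \<cdot> m X \<cdot> farr F \<omega>" by (simp add: s)
  also have "\<dots> = \<epsilon> X' \<cdot> (farr F h \<cdot> m X) \<cdot> farr F \<omega>"
    unfolding naturality(3)[OF hom] by (simp add: s)
  also have "\<dots> = \<epsilon> X' \<cdot> m X' \<cdot> farr F (farr F h \<cdot> \<omega>)"
    unfolding naturality(1)[OF hom] by (simp add: s)
  also have "\<dots> = (\<epsilon> X' \<cdot> m X' \<cdot> farr F \<omega>') \<cdot> farr F h"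
    unfolding c by (simp add: s)
  finally show ?thesis
    using hom h by (simp add: frobenius_bimodule_hom_def module_hom_def induced_action_def)
qed

section \<open>The categories of compatible comodules and bimodules, and the functors between
  them\<close>

lemma compat_comodule_cat_eq:
  "compat_comodule_cat B F \<delta> \<epsilon> = structured_cat B
     {M. is_comodule B F \<delta> M \<and> gamma_compatible B F \<delta> \<epsilon> M} (\<lambda>(X, \<omega>). X) (comodule_hom B F)"
  by (simp add: compat_comodule_cat_def comodule_cat_def full_subcat_structured_cat)

lemma compat_frobenius_cat_eq:
  "compat_frobenius_cat B F m \<delta> \<epsilon> = structured_cat B
     {M. frobenius_bimodule B F m \<delta> M \<and> (case M of (X, \<rho>, \<omega>) \<Rightarrow> gamma_compatible B F \<delta> \<epsilon> (X, \<omega>))}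
     (\<lambda>(X, \<rho>, \<omega>). X) (frobenius_bimodule_hom B F)"
  by (simp add: compat_frobenius_cat_def frobenius_cat_def full_subcat_structured_cat)

lemma compat_action_frobenius_cat_eq:
  "compat_action_frobenius_cat B F m \<delta> \<epsilon> = structured_cat B
     {M. frobenius_bimodule B F m \<delta> M \<and> (case M of (X, \<rho>, \<omega>) \<Rightarrow>
       gamma_compatible B F \<delta> \<epsilon> (X, \<omega>) \<and> gamma_compatible_hom B \<epsilon> (fobj F X, \<delta> X) \<rho>)}
     (\<lambda>(X, \<rho>, \<omega>). X) (frobenius_bimodule_hom B F)"
  unfolding compat_action_frobenius_cat_def compat_frobenius_cat_eq full_subcat_structured_cat
  \<comment> \<open>Only the object sets differ: the nested comprehension of the two restrictions is
    merged into one.\<close>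
  by (rule arg_cong[where f = "\<lambda>S. structured_cat B S _ _"]) auto

text \<open>The smaller target is possible because the induced action is itself a compatible
  comodule morphism.\<close>

lemma is_functor_Psi:
  "is_functor (compat_comodule_cat B F \<delta> \<epsilon>) (compat_frobenius_cat B F m \<delta> \<epsilon>) (Psi B F m \<epsilon>)"
  "is_functor (compat_comodule_cat B F \<delta> \<epsilon>) (compat_action_frobenius_cat B F m \<delta> \<epsilon>)
     (Psi B F m \<epsilon>)"
  unfolding compat_comodule_cat_eq compat_frobenius_cat_eq compat_action_frobenius_cat_eq
    Psi_eq_over_func
  by (intro is_functor_over_func concrete_over_comodules concrete_over_bimodules;
      auto simp: add_action_def compat_frobenius_action_def
        dest: compat_frobenius_action_induced_action intro: frobenius_bimodule_hom_induced_action)+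

lemma is_functor_forget_action:
  "is_functor (compat_frobenius_cat B F m \<delta> \<epsilon>) (compat_comodule_cat B F \<delta> \<epsilon>) forget_action"
  "is_functor (compat_action_frobenius_cat B F m \<delta> \<epsilon>) (compat_comodule_cat B F \<delta> \<epsilon>)
     forget_action"
  unfolding compat_comodule_cat_eq compat_frobenius_cat_eq compat_action_frobenius_cat_eq
    forget_action_eq_over_func
  by (intro is_functor_over_func concrete_over_comodules concrete_over_bimodules;
      auto simp: frobenius_bimodule_def frobenius_bimodule_hom_def)+

text \<open>Forgetting after \<open>Psi\<close> clearly restores the comodule. The other round trip
  can change only the action, and uniqueness of compatible actions excludes that; this is why the
  target is restricted to bimodules with compatible action.\<close>

lemma iso_with_inverse_Psi:
  "iso_with_inverse (compat_comodule_cat B F \<delta> \<epsilon>) (compat_action_frobenius_cat B F m \<delta> \<epsilon>)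
     (Psi B F m \<epsilon>) forget_action"
proof -
  have "func_agree (compat_comodule_cat B F \<delta> \<epsilon>) (comp_func forget_action (Psi B F m \<epsilon>)) id_func"
    unfolding compat_comodule_cat_eq Psi_eq_over_func forget_action_eq_over_func
    by (rule func_agree_over_func) (auto simp: add_action_def)
  moreover have "func_agree (compat_action_frobenius_cat B F m \<delta> \<epsilon>)
      (comp_func (Psi B F m \<epsilon>) forget_action) id_func"
    unfolding compat_action_frobenius_cat_eq Psi_eq_over_func forget_action_eq_over_func
  proof (rule func_agree_over_func, clarsimp simp: add_action_def)
    fix X \<rho> \<omega>
    assume bim: "frobenius_bimodule B F m \<delta> (X, \<rho>, \<omega>)"
      and compat: "gamma_compatible_hom B \<epsilon> (fobj F X, \<delta> X) \<rho>"
    \<comment> \<open>The bimodule equation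
      \<open>F \<rho> \<cdot> \<delta> X = \<omega> \<cdot> \<rho>\<close> says exactly that
      \<open>\<rho>\<close> is a comodule morphism from the cofree-type comodule on
      \<open>fobj F X\<close>.\<close>
    have "compat_frobenius_action B F m \<delta> \<epsilon> (X, \<omega>) \<rho>"
      using bim compat
      by (auto simp: compat_frobenius_action_def frobenius_bimodule_def comodule_hom_def
          is_module_def)
    then show "induced_action B F m \<epsilon> (X, \<omega>) = \<rho>"
      using compat_frobenius_action_unique by simp
  qed
  ultimately show ?thesis
    by (simp add: iso_with_inverse_def is_functor_Psi is_functor_forget_action)
qed

end

theorem theorem4p2:
  fixes B :: "('o, 'm) cat"
    and F :: "('o, 'm, 'o, 'm) func"
    and m \<delta> \<epsilon> :: "'o \<Rightarrow> 'm"
  assumes "nonunital_monad B F m"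
    and "noncounital_comonad B F \<delta>"
    and "frobenius_property B F m \<delta>"
    and "nat_trans B B F id_func \<epsilon>"
    and "weak_comonad B F \<delta> \<epsilon>"
    and "\<forall>X\<in>Obj B. m X = gamma B F \<delta> \<epsilon> X \<cdot>\<^bsub>B\<^esub> m X"
  shows
    "(\<forall>X \<omega>. is_comodule B F \<delta> (X, \<omega>) \<and> gamma_compatible B F \<delta> \<epsilon> (X, \<omega>) \<longrightarrow>
        (\<exists>!\<rho>. compat_frobenius_action B F m \<delta> \<epsilon> (X, \<omega>) \<rho>) \<and>
        compat_frobenius_action B F m \<delta> \<epsilon> (X, \<omega>) (induced_action B F m \<epsilon> (X, \<omega>)))
     \<and>
     (\<forall>X \<omega> X' \<omega>' h.
        is_comodule B F \<delta> (X, \<omega>) \<and> gamma_compatible B F \<delta> \<epsilon> (X, \<omega>) \<and>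
        is_comodule B F \<delta> (X', \<omega>') \<and> gamma_compatible B F \<delta> \<epsilon> (X', \<omega>') \<and>
        comodule_hom B F (X, \<omega>) (X', \<omega>') h \<longrightarrow>
        frobenius_bimodule_hom B F
          (X, induced_action B F m \<epsilon> (X, \<omega>), \<omega>)
          (X', induced_action B F m \<epsilon> (X', \<omega>'), \<omega>') h)
     \<and>
     is_functor (compat_comodule_cat B F \<delta> \<epsilon>) (compat_frobenius_cat B F m \<delta> \<epsilon>) (Psi B F m \<epsilon>) \<and>
     is_functor (compat_frobenius_cat B F m \<delta> \<epsilon>) (compat_comodule_cat B F \<delta> \<epsilon>) forget_action \<and>
     iso_with_inverse (compat_comodule_cat B F \<delta> \<epsilon>) (compat_action_frobenius_cat B F m \<delta> \<epsilon>)
       (Psi B F m \<epsilon>) forget_action"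
proof -
  \<comment> \<open>That \<open>F\<close> is an endofunctor of a category is read off from
    \<open>nat_trans\<close>, whose definition includes functoriality of both ends.\<close>
  interpret weak_frobenius_functor B F m \<delta> \<epsilon>
    using assms
    by (auto simp: nat_trans_def endofunctor_def weak_frobenius_functor_def
        weak_frobenius_functor_axioms_def)
  show ?thesis
    using compat_frobenius_action_induced_action compat_frobenius_action_unique
      frobenius_bimodule_hom_induced_action is_functor_Psi(1) is_functor_forget_action(1)
      iso_with_inverse_Psi
    by blast
qed

end
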